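(* Assume $U,V\subseteq\{0,1\}^n$ are disjoint and non-empty and $U$ is closed upwards (or $V$ downwards). Let $C$ be a monotone real circuit of size $s$ separating $U$ from $V$. Then for every $0<\epsilon<\frac12$ there is a monotone circuit with a local oracle (CLO) $D$ separating $U$ from $V$, having size $s\left(\frac n\epsilon\right)^{O(1)}$ and locality $\mu\le s\epsilon$. In particular, for any $\mu>0$ there is a monotone CLO separating $U$ from $V$ with locality $\le\mu$ and size $(n\,s\,\mu^{-1})^{O(1)}$.
   Context: $O(1)$ denotes an absolute constant; orders on $\{0,1\}^n$ are coordinatewise. A monotone real circuit is a circuit with inputs $x_1,\dots,x_n\in\{0,1\}$ whose gates compute arbitrary non-decreasing real functions (of at most two real arguments); its size is the number of its nodes. It separates $U$ from $V$ if it outputs $1$ on all of $U$ and $0$ on all of $V$. Monotone CLO. A monotone circuit with a local oracle separating $U$ from $V$ consists of (1) a monotone Boolean circuit $D(x_1,\dots,x_n,y_1,\dots,y_e)$ and (2) a set of combinatorial rectangles $U_j\times V_j\subseteq U\times V$, $j\le e$ (oracle rectangles), such that (3) for all monotone Boolean functions $f_j:\{0,1\}^n\to\{0,1\}$, $j\le e$, with $f_j(U_j)\subseteq\{1\}$ and $f_j(V_j)\subseteq\{0\}$, the function $\overline x\mapsto D(\overline x,f_1(\overline x),\dots,f_e(\overline x))$ is identically $1$ on $U$ and identically $0$ on $V$. Its size is the size (number of nodes) of $D$ and its locality is $|\bigcup_{j\le e}U_j\times V_j|/|U\times V|$.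
   Formalization: In the second part the size bound is max(1, nsμ⁻¹)^{O(1)} in place of (nsμ⁻¹)^{O(1)}: for μ > ns the literal bound is below 1, which no circuit (at least one node) can meet; for μ ≤ ns the two agree. *)

theory Defs
  imports Complex_Main
begin

definition cube :: "nat \<Rightarrow> bool list set" where
  "cube n = {x. length x = n}"

abbreviation cw_le :: "bool list \<Rightarrow> bool list \<Rightarrow> bool" (infix "\<preceq>" 50) where
  "x \<preceq> y \<equiv> list_all2 (\<le>) x y"

definition upward_closed :: "nat \<Rightarrow> bool list set \<Rightarrow> bool" where
  "upward_closed n U \<longleftrightarrow> (\<forall>x\<in>U. \<forall>y\<in>cube n. x \<preceq> y \<longrightarrow> y \<in> U)"

definition downward_closed :: "nat \<Rightarrow> bool list set \<Rightarrow> bool" where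
  "downward_closed n V \<longleftrightarrow> (\<forall>x\<in>V. \<forall>y\<in>cube n. y \<preceq> x \<longrightarrow> y \<in> V)"

text \<open>
  A circuit is the list of its nodes in a topological order; a gate refers to its predecessors by
  their positions in the list, and the last node is the output. Input nodes count as nodes, so
  the size of a circuit is the length of the list.
\<close>

definition node_values :: "('v list \<Rightarrow> 'g \<Rightarrow> 'v) \<Rightarrow> 'g list \<Rightarrow> 'v list" where
  "node_values val C = foldl (\<lambda>vs g. vs @ [val vs g]) [] C"

definition output_value :: "('v list \<Rightarrow> 'g \<Rightarrow> 'v) \<Rightarrow> 'g list \<Rightarrow> 'v" where
  "output_value val C = last (node_values val C)"

datatype real_node =
    RInput nat
  | RConst real
  | RUnary "real \<Rightarrow> real" nat
  | RBinary "real \<Rightarrow> real \<Rightarrow> real" nat nat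

fun real_node_ok :: "nat \<Rightarrow> nat \<Rightarrow> real_node \<Rightarrow> bool" where
  "real_node_ok n k (RInput i) \<longleftrightarrow> i < n"
| "real_node_ok n k (RConst r) \<longleftrightarrow> True"
| "real_node_ok n k (RUnary g i) \<longleftrightarrow> mono g \<and> i < k"
| "real_node_ok n k (RBinary g i j) \<longleftrightarrow>
     (\<forall>a a' b b'. a \<le> a' \<and> b \<le> b' \<longrightarrow> g a b \<le> g a' b') \<and> i < k \<and> j < k"

fun real_node_value :: "bool list \<Rightarrow> real list \<Rightarrow> real_node \<Rightarrow> real" where
  "real_node_value x vs (RInput i) = of_bool (x ! i)"
| "real_node_value x vs (RConst r) = r"
| "real_node_value x vs (RUnary g i) = g (vs ! i)"
| "real_node_value x vs (RBinary g i j) = g (vs ! i) (vs ! j)"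

definition monotone_real_circuit :: "nat \<Rightarrow> real_node list \<Rightarrow> bool" where
  "monotone_real_circuit n C \<longleftrightarrow> C \<noteq> [] \<and> (\<forall>k<length C. real_node_ok n k (C ! k))"

definition real_eval :: "real_node list \<Rightarrow> bool list \<Rightarrow> real" where
  "real_eval C x = output_value (real_node_value x) C"

definition real_circuit_separates :: "real_node list \<Rightarrow> bool list set \<Rightarrow> bool list set \<Rightarrow> bool" where
  "real_circuit_separates C U V \<longleftrightarrow> (\<forall>u\<in>U. real_eval C u = 1) \<and> (\<forall>v\<in>V. real_eval C v = 0)"

datatype bool_node =
    BInput nat
  | BConst bool
  | BAnd nat nat
  | BOr nat nat

fun bool_node_ok :: "nat \<Rightarrow> nat \<Rightarrow> bool_node \<Rightarrow> bool" where
  "bool_node_ok m k (BInput i) \<longleftrightarrow> i < m"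
| "bool_node_ok m k (BConst b) \<longleftrightarrow> True"
| "bool_node_ok m k (BAnd i j) \<longleftrightarrow> i < k \<and> j < k"
| "bool_node_ok m k (BOr i j) \<longleftrightarrow> i < k \<and> j < k"

fun bool_node_value :: "bool list \<Rightarrow> bool list \<Rightarrow> bool_node \<Rightarrow> bool" where
  "bool_node_value z vs (BInput i) \<longleftrightarrow> z ! i"
| "bool_node_value z vs (BConst b) \<longleftrightarrow> b"
| "bool_node_value z vs (BAnd i j) \<longleftrightarrow> vs ! i \<and> vs ! j"
| "bool_node_value z vs (BOr i j) \<longleftrightarrow> vs ! i \<or> vs ! j"

definition monotone_bool_circuit :: "nat \<Rightarrow> bool_node list \<Rightarrow> bool" where
  "monotone_bool_circuit m D \<longleftrightarrow> D \<noteq> [] \<and> (\<forall>k<length D. bool_node_ok m k (D ! k))"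

definition bool_eval :: "bool_node list \<Rightarrow> bool list \<Rightarrow> bool" where
  "bool_eval D z = output_value (bool_node_value z) D"

text \<open>
  The oracle rectangles are the products of the pairs in the list \<open>R\<close>. The circuit \<open>D\<close> has
  \<open>n + length R\<close> inputs: the bits of \<open>x\<close>, followed by one oracle bit per rectangle.
\<close>

definition monotone_CLO ::
  "nat \<Rightarrow> bool list set \<Rightarrow> bool list set \<Rightarrow> bool_node list \<Rightarrow> (bool list set \<times> bool list set) list \<Rightarrow> bool"
where
  "monotone_CLO n U V D R \<longleftrightarrow>
     monotone_bool_circuit (n + length R) D \<and>
     (\<forall>(A, B)\<in>set R. A \<subseteq> U \<and> B \<subseteq> V) \<and>
     (\<forall>f :: nat \<Rightarrow> bool list \<Rightarrow> bool.
        (\<forall>j<length R. monotone_on (cube n) (\<preceq>) (\<le>) (f j) \<and>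
           (\<forall>u\<in>fst (R ! j). f j u) \<and> (\<forall>v\<in>snd (R ! j). \<not> f j v)) \<longrightarrow>
        (\<forall>u\<in>U. bool_eval D (u @ map (\<lambda>j. f j u) [0..<length R])) \<and>
        (\<forall>v\<in>V. \<not> bool_eval D (v @ map (\<lambda>j. f j v) [0..<length R])))"

definition locality ::
  "bool list set \<Rightarrow> bool list set \<Rightarrow> (bool list set \<times> bool list set) list \<Rightarrow> real" where
  "locality U V R = real (card (\<Union>(A, B)\<in>set R. A \<times> B)) / real (card (U \<times> V))"

end

theory Submission
  imports Defs
begin

text \<open>
  Write \<open>g\<^sub>k\<close> for the function computed by node \<open>k\<close> of the real circuit. For every \<open>k\<close>, sort \<open>U\<close>
  into about \<open>1/\<epsilon>\<close> buckets according to the fraction of \<open>v \<in> V\<close> with \<open>g\<^sub>k v < g\<^sub>k u\<close>. The pairs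
  \<open>(u, v)\<close> such that \<open>g\<^sub>k v\<close> lies between two \<open>g\<^sub>k\<close>-values of the bucket of \<open>u\<close> form one rectangle
  per bucket, and these rectangles cover at most an \<open>\<epsilon>\<close>-fraction of \<open>U \<times> V\<close>; they are the oracle
  rectangles. For every bucket \<open>A\<close> of node \<open>k\<close> the Boolean circuit computes a bit that is \<open>1\<close> on
  \<open>A\<close> and \<open>0\<close> on each \<open>v\<close> with \<open>g\<^sub>k v < g\<^sub>k u\<close> for some \<open>u \<in> A\<close>. If \<open>k\<close> has predecessors \<open>i\<close> and \<open>j\<close>,
  this bit is the conjunction of the oracle bit of \<open>A\<close> with the disjunction, over \<open>u \<in> A\<close>, of the
  conjunctions of the bits of the buckets of \<open>u\<close> at \<open>i\<close> and at \<open>j\<close>: when \<open>v\<close> lies below all of \<open>A\<close>,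
  monotonicity gives \<open>g\<^sub>i v < g\<^sub>i u\<close> or \<open>g\<^sub>j v < g\<^sub>j u\<close> for every \<open>u \<in> A\<close>, and otherwise the oracle bit
  vanishes on \<open>v\<close>.
\<close>

section \<open>Node values\<close>

lemma node_values_Nil [simp]: "node_values val [] = []"
  by (simp add: node_values_def)

lemma node_values_snoc [simp]:
  "node_values val (C @ [g]) = node_values val C @ [val (node_values val C) g]"
  by (simp add: node_values_def)

lemma length_node_values [simp]: "length (node_values val C) = length C"
  by (induction C rule: rev_induct) auto

lemma nth_node_values:
  "k < length C \<Longrightarrow> node_values val C ! k = val (take k (node_values val C)) (C ! k)"
  by (induction C rule: rev_induct) (auto simp: nth_append less_Suc_eq)

lemma output_value_eq_nth:
  "C \<noteq> [] \<Longrightarrow> output_value val C = node_values val C ! (length C - 1)"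
  by (metis last_conv_nth length_0_conv length_node_values output_value_def)

section \<open>Families computed by monotone Boolean circuits\<close>

text \<open>One node list serves the whole family, so subcircuits are shared and each new function
  costs only its own gates. The list may be empty, which lets an induction start from the empty
  family with \<open>N = 0\<close>.\<close>

definition computable_within :: "nat \<Rightarrow> nat \<Rightarrow> (bool list \<Rightarrow> bool) set \<Rightarrow> bool" where
  "computable_within m N F \<longleftrightarrow> (\<exists>D. length D \<le> N \<and> (\<forall>k<length D. bool_node_ok m k (D ! k)) \<and>
     (\<forall>f\<in>F. \<exists>p<length D. \<forall>z. node_values (bool_node_value z) D ! p = f z))"

lemma computable_within_empty: "computable_within m 0 {}"
  by (auto simp: computable_within_def)

lemma computable_within_mono:
  assumes "computable_within m N F" "G \<subseteq> F" "N \<le> N'"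
  shows "computable_within m N' G"
proof -
  obtain D where "length D \<le> N" "\<forall>k<length D. bool_node_ok m k (D ! k)"
    "\<forall>f\<in>F. \<exists>p<length D. \<forall>z. node_values (bool_node_value z) D ! p = f z"
    using assms(1) unfolding computable_within_def by blast
  then show ?thesis
    unfolding computable_within_def using assms(2,3) by (intro exI[of _ D]) (auto simp: subset_iff)
qed

lemma computable_within_add_node:
  assumes len: "length D \<le> N" and ok: "\<forall>k<length D. bool_node_ok m k (D ! k)"
    and F: "\<forall>f\<in>F. \<exists>p<length D. \<forall>z. node_values (bool_node_value z) D ! p = f z"
    and g: "bool_node_ok m (length D) g"
    and h: "\<And>z. bool_node_value z (node_values (bool_node_value z) D) g = h z"
  shows "computable_within m (N + 1) (insert h F)"
  unfolding computable_within_def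
proof (intro exI[of _ "D @ [g]"] conjI ballI)
  show "length (D @ [g]) \<le> N + 1" using len by simp
  show "\<forall>k<length (D @ [g]). bool_node_ok m k ((D @ [g]) ! k)"
    using ok g by (auto simp: nth_append less_Suc_eq)
next
  fix f assume "f \<in> insert h F"
  then show "\<exists>p<length (D @ [g]). \<forall>z. node_values (bool_node_value z) (D @ [g]) ! p = f z"
  proof
    assume "f = h"
    then show ?thesis using h by (intro exI[of _ "length D"]) (simp add: nth_append)
  next
    assume "f \<in> F"
    then obtain p where "p < length D" "\<forall>z. node_values (bool_node_value z) D ! p = f z"
      using F by blast
    then show ?thesis by (intro exI[of _ p]) (simp add: nth_append)
  qed
qed

lemma computable_within_input:
  assumes "computable_within m N F" "i < m"
  shows "computable_within m (N + 1) (insert (\<lambda>z. z ! i) F)"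
proof -
  obtain D where D: "length D \<le> N" "\<forall>k<length D. bool_node_ok m k (D ! k)"
    "\<forall>f\<in>F. \<exists>p<length D. \<forall>z. node_values (bool_node_value z) D ! p = f z"
    using assms(1) unfolding computable_within_def by blast
  show ?thesis by (rule computable_within_add_node[OF D, of "BInput i"]) (use assms in simp_all)
qed

lemma computable_within_const:
  assumes "computable_within m N F"
  shows "computable_within m (N + 1) (insert (\<lambda>z. b) F)"
proof -
  obtain D where D: "length D \<le> N" "\<forall>k<length D. bool_node_ok m k (D ! k)"
    "\<forall>f\<in>F. \<exists>p<length D. \<forall>z. node_values (bool_node_value z) D ! p = f z"
    using assms unfolding computable_within_def by blast
  show ?thesis by (rule computable_within_add_node[OF D, of "BConst b"]) (use assms in simp_all)
qed

lemma computable_within_conj: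
  assumes "computable_within m N F" "f \<in> F" "g \<in> F"
  shows "computable_within m (N + 1) (insert (\<lambda>z. f z \<and> g z) F)"
proof -
  obtain D where D: "length D \<le> N" "\<forall>k<length D. bool_node_ok m k (D ! k)"
    "\<forall>f\<in>F. \<exists>p<length D. \<forall>z. node_values (bool_node_value z) D ! p = f z"
    using assms(1) unfolding computable_within_def by blast
  obtain p where p: "p < length D" "\<forall>z. node_values (bool_node_value z) D ! p = f z"
    using bspec[OF D(3) assms(2)] by blast
  obtain q where q: "q < length D" "\<forall>z. node_values (bool_node_value z) D ! q = g z"
    using bspec[OF D(3) assms(3)] by blast
  from p q show ?thesis by (intro computable_within_add_node[OF D, of "BAnd p q"]) auto
qed

lemma computable_within_disj:
  assumes "computable_within m N F" "f \<in> F" "g \<in> F"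
  shows "computable_within m (N + 1) (insert (\<lambda>z. f z \<or> g z) F)"
proof -
  obtain D where D: "length D \<le> N" "\<forall>k<length D. bool_node_ok m k (D ! k)"
    "\<forall>f\<in>F. \<exists>p<length D. \<forall>z. node_values (bool_node_value z) D ! p = f z"
    using assms(1) unfolding computable_within_def by blast
  obtain p where p: "p < length D" "\<forall>z. node_values (bool_node_value z) D ! p = f z"
    using bspec[OF D(3) assms(2)] by blast
  obtain q where q: "q < length D" "\<forall>z. node_values (bool_node_value z) D ! q = g z"
    using bspec[OF D(3) assms(3)] by blast
  from p q show ?thesis by (intro computable_within_add_node[OF D, of "BOr p q"]) auto
qed

text \<open>Start with the constant \<open>False\<close>; every index then costs one conjunction and
  one disjunction. \<open>F\<close> stays available for later gates, while the partial disjunctions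
  are forgotten by \<open>computable_within_mono\<close>.\<close>

lemma computable_within_DNF:
  assumes "finite I" "computable_within m N F" "\<And>i. i \<in> I \<Longrightarrow> a i \<in> F \<and> b i \<in> F"
  shows "computable_within m (N + (2 * card I + 1)) (insert (\<lambda>z. \<exists>i\<in>I. a i z \<and> b i z) F)"
  using assms(1,3)
proof (induction I rule: finite_induct)
  case empty
  then show ?case using computable_within_const[OF assms(2), of False] by simp
next
  case (insert i I)
  let ?acc = "\<lambda>z. \<exists>i\<in>I. a i z \<and> b i z" and ?ai = "\<lambda>z. a i z \<and> b i z"
  have "computable_within m (N + (2 * card I + 1)) (insert ?acc F)"
    using insert by blast
  then have "computable_within m (N + (2 * card I + 1) + 1) (insert ?ai (insert ?acc F))"
    using insert.prems by (intro computable_within_conj) auto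
  then have "computable_within m (N + (2 * card I + 1) + 1 + 1)
      (insert (\<lambda>z. ?ai z \<or> ?acc z) (insert ?ai (insert ?acc F)))"
    by (rule computable_within_disj) auto
  then show ?case
    by (rule computable_within_mono) (use insert.hyps in auto)
qed

lemma computable_within_circuit:
  assumes "computable_within m N F" "f \<in> F"
  obtains D where "monotone_bool_circuit m D" "length D \<le> N + 1" "\<And>z. bool_eval D z = f z"
proof -
  obtain D where D: "length D \<le> N" "\<forall>k<length D. bool_node_ok m k (D ! k)"
    "\<forall>f\<in>F. \<exists>p<length D. \<forall>z. node_values (bool_node_value z) D ! p = f z"
    using assms(1) unfolding computable_within_def by blast
  obtain p where "p < length D" "\<forall>z. node_values (bool_node_value z) D ! p = f z"
    using bspec[OF D(3) assms(2)] by blast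
  \<comment> \<open>The output of a circuit is its last node, so the idle gate
    \<open>BAnd p p\<close> copies the value at position \<open>p\<close> to the end. This is the
    additional node in the bound.\<close>
  then show ?thesis using D(1,2)
    by (intro that[of "D @ [BAnd p p]"])
      (auto simp: monotone_bool_circuit_def bool_eval_def output_value_def nth_append less_Suc_eq)
qed

section \<open>Buckets\<close>

definition bucket :: "'a set \<Rightarrow> ('a \<Rightarrow> nat) \<Rightarrow> nat \<Rightarrow> 'a set" where
  "bucket U q m = {u\<in>U. q u = m}"

text \<open>An element of \<open>V\<close> outside this set is either strictly below every element
  of the bucket or strictly below none. The straddled elements are thus exactly those on which
  "below some" and "below all" differ.\<close>

definition straddled :: "'a set \<Rightarrow> 'a set \<Rightarrow> ('a \<Rightarrow> real) \<Rightarrow> ('a \<Rightarrow> nat) \<Rightarrow> nat \<Rightarrow> 'a set" where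
  "straddled U V g q m = {v\<in>V. \<exists>u\<in>bucket U q m. \<exists>u'\<in>bucket U q m. g u \<le> g v \<and> g v < g u'}"

text \<open>Inside one bucket the numbers of elements of \<open>V\<close> below two points differ by
  less than \<epsilon> times \<open>card V\<close>, and the straddled elements are counted by such a
  difference. As the buckets partition \<open>U\<close>, summing over them loses nothing.\<close>

lemma exists_bucketing:
  fixes g :: "'a \<Rightarrow> real"
  assumes fin: "finite U" "finite V" and "V \<noteq> {}" and \<epsilon>: "\<epsilon> > 0"
  obtains q where "\<And>u. q u < nat \<lfloor>1 / \<epsilon>\<rfloor> + 1"
    and "real (card (\<Union>m. bucket U q m \<times> straddled U V g q m)) \<le> \<epsilon> * real (card (U \<times> V))"
proof -
  define M where "M = nat \<lfloor>1 / \<epsilon>\<rfloor> + 1"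
  define below where "below u = {v\<in>V. g v < g u}" for u
  \<comment> \<open>The rank of \<open>u\<close> among the values on \<open>V\<close>, measured in
    units of \<epsilon> times \<open>card V\<close> and rounded down.\<close>
  define q where "q u = nat \<lfloor>real (card (below u)) / (\<epsilon> * real (card V))\<rfloor>" for u
  have V: "real (card V) > 0" using assms by (simp add: card_gt_0_iff)
  have qM: "q u < M" for u
  proof -
    have "real (card (below u)) \<le> real (card V)"
      using fin by (auto simp: below_def intro!: card_mono)
    then have "real (card (below u)) / (\<epsilon> * real (card V)) \<le> 1 / \<epsilon>"
      using V \<epsilon> by (simp add: field_simps)
    then have "q u \<le> nat \<lfloor>1 / \<epsilon>\<rfloor>" unfolding q_def by (intro nat_mono floor_mono)
    then show ?thesis by (simp add: M_def)
  qed
  have strad: "real (card (straddled U V g q m)) \<le> \<epsilon> * real (card V)" for m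
  proof (cases "bucket U q m = {}")
    case True
    then show ?thesis using V \<epsilon> by (simp add: straddled_def)
  next
    case False
    have finb: "finite (bucket U q m)" using fin by (simp add: bucket_def)
    \<comment> \<open>An element of minimal and one of maximal value: being straddled by the bucket
      is being straddled by this pair.\<close>
    define lo where "lo = arg_min_on g (bucket U q m)"
    define hi where "hi = arg_min_on (\<lambda>u. - g u) (bucket U q m)"
    have lo: "lo \<in> bucket U q m" "\<And>u. u \<in> bucket U q m \<Longrightarrow> g lo \<le> g u"
      unfolding lo_def using arg_min_if_finite(1)[OF finb False] arg_min_least[OF finb False] by auto
    have hi: "hi \<in> bucket U q m" "\<And>u. u \<in> bucket U q m \<Longrightarrow> g u \<le> g hi"
      unfolding hi_def using arg_min_if_finite(1)[OF finb False, of "\<lambda>u. - g u"]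
        arg_min_least[OF finb False, of _ "\<lambda>u. - g u"] by auto
    have sub: "below lo \<subseteq> below hi" using lo(2)[OF hi(1)] by (auto simp: below_def)
    have finbelow: "finite (below u)" for u using fin by (simp add: below_def)
    have "straddled U V g q m \<subseteq> below hi - below lo"
    proof
      fix v assume "v \<in> straddled U V g q m"
      then obtain u u' where "v \<in> V" "u \<in> bucket U q m" "u' \<in> bucket U q m" "g u \<le> g v" "g v < g u'"
        by (auto simp: straddled_def)
      then show "v \<in> below hi - below lo" using lo(2)[of u] hi(2)[of u'] by (auto simp: below_def)
    qed
    then have "card (straddled U V g q m) \<le> card (below hi - below lo)"
      using finbelow by (intro card_mono) auto
    also have "\<dots> = card (below hi) - card (below lo)"
      using sub finbelow by (intro card_Diff_subset)
    finally have c: "real (card (straddled U V g q m)) \<le> real (card (below hi)) - real (card (below lo))"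
      using card_mono[OF finbelow sub] by linarith
    have "q lo = m" "q hi = m" using lo(1) hi(1) by (auto simp: bucket_def)
    have pos: "\<epsilon> * real (card V) > 0" using V \<epsilon> by simp
    \<comment> \<open>Positivity turns the truncation \<open>nat\<close> into an exact statement
      about the floor, which bounds the count from both sides.\<close>
    have flo: "\<lfloor>real (card (below u)) / (\<epsilon> * real (card V))\<rfloor> = int m" if "q u = m" for u
      using that pos by (auto simp: q_def)
    have "real m \<le> real (card (below lo)) / (\<epsilon> * real (card V))"
      using flo[OF \<open>q lo = m\<close>] by linarith
    moreover have "real (card (below hi)) / (\<epsilon> * real (card V)) < real m + 1"
      using flo[OF \<open>q hi = m\<close>] by linarith
    ultimately have "real m * (\<epsilon> * real (card V)) \<le> real (card (below lo))"
      "real (card (below hi)) < (real m + 1) * (\<epsilon> * real (card V))"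
      using pos by (simp_all only: pos_le_divide_eq pos_divide_less_eq)
    then show ?thesis using c by (simp add: algebra_simps)
  qed
  have finb: "finite (bucket U q m)" for m using fin by (simp add: bucket_def)
  have "bucket U q m = {}" if "m \<ge> M" for m
    using qM that by (auto simp: bucket_def not_le[symmetric])
  then have "(\<Union>m. bucket U q m \<times> straddled U V g q m) = (\<Union>m<M. bucket U q m \<times> straddled U V g q m)"
    by (auto simp: bucket_def qM)
  then have "card (\<Union>m. bucket U q m \<times> straddled U V g q m)
      \<le> (\<Sum>m<M. card (bucket U q m \<times> straddled U V g q m))"
    by (simp add: card_UN_le)
  then have "real (card (\<Union>m. bucket U q m \<times> straddled U V g q m))
      \<le> (\<Sum>m<M. real (card (bucket U q m)) * real (card (straddled U V g q m)))"
    by (simp add: card_cartesian_product flip: of_nat_mult of_nat_sum)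
  also have "\<dots> \<le> (\<Sum>m<M. real (card (bucket U q m)) * (\<epsilon> * real (card V)))"
    by (intro sum_mono mult_left_mono strad) simp
  also have "\<dots> = real (\<Sum>m<M. card (bucket U q m)) * (\<epsilon> * real (card V))"
    by (simp add: sum_distrib_right)
  also have "(\<Sum>m<M. card (bucket U q m)) = card (\<Union>m<M. bucket U q m)"
    by (rule card_UN_disjoint[symmetric]) (use finb in \<open>auto simp: bucket_def\<close>)
  also have "(\<Union>m<M. bucket U q m) = U"
    using qM by (auto simp: bucket_def)
  finally show ?thesis
    using that[of q] qM by (simp add: card_cartesian_product M_def mult_ac)
qed

section \<open>The Boolean circuit of a bucketed real circuit\<close>

text \<open>Correctness and size are proved for an arbitrary bucketing with indices below
  \<open>M\<close>; the choice of buckets enters only through the locality.\<close>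

locale bucketed_real_circuit =
  fixes n :: nat and U V :: "bool list set" and C :: "real_node list"
    and q :: "nat \<Rightarrow> bool list \<Rightarrow> nat" and M :: nat
  assumes cube: "U \<subseteq> cube n" "V \<subseteq> cube n"
    and circuit: "monotone_real_circuit n C"
    and q_less: "\<And>k u. q k u < M"
begin

definition node_fun :: "nat \<Rightarrow> bool list \<Rightarrow> real" where
  "node_fun k x = node_values (real_node_value x) C ! k"

text \<open>Bucket \<open>m\<close> of node \<open>k\<close> gets the index
  \<open>k * M + m\<close>, so all buckets of a node come after those of its predecessors.\<close>

definition rectangles :: "(bool list set \<times> bool list set) list" where
  "rectangles = map (\<lambda>j. (bucket U (q (j div M)) (j mod M),
     straddled U V (node_fun (j div M)) (q (j div M)) (j mod M))) [0..<length C * M]"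

definition admissible :: "(nat \<Rightarrow> bool list \<Rightarrow> bool) \<Rightarrow> bool" where
  "admissible f \<longleftrightarrow> (\<forall>j<length rectangles.
     (\<forall>u\<in>fst (rectangles ! j). f j u) \<and> (\<forall>v\<in>snd (rectangles ! j). \<not> f j v))"

definition with_oracle :: "(nat \<Rightarrow> bool list \<Rightarrow> bool) \<Rightarrow> bool list \<Rightarrow> bool list" where
  "with_oracle f x = x @ map (\<lambda>j. f j x) [0..<length rectangles]"

text \<open>The strong invariant for finished bits: being below a single element of the bucket
  forces rejection, so a later gate may apply it to any \<open>u\<close> of its choice.\<close>

definition separates_bucket :: "nat \<Rightarrow> nat \<Rightarrow> (bool list \<Rightarrow> bool) \<Rightarrow> bool" where
  "separates_bucket k m w \<longleftrightarrow> (\<forall>f. admissible f \<longrightarrow>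
     (\<forall>u\<in>bucket U (q k) m. w (with_oracle f u)) \<and>
     (\<forall>v\<in>V. (\<exists>u\<in>bucket U (q k) m. node_fun k v < node_fun k u) \<longrightarrow> \<not> w (with_oracle f v)))"

text \<open>The weaker property that a gate can guarantee before its oracle bit is consulted.
  Without the non-emptiness guard, an empty bucket would demand rejection of all of
  \<open>V\<close>.\<close>

definition separates_below :: "nat \<Rightarrow> nat \<Rightarrow> (bool list \<Rightarrow> bool) \<Rightarrow> bool" where
  "separates_below k m z \<longleftrightarrow> (\<forall>f. admissible f \<longrightarrow>
     (\<forall>u\<in>bucket U (q k) m. z (with_oracle f u)) \<and>
     (\<forall>v\<in>V. bucket U (q k) m \<noteq> {} \<and> (\<forall>u\<in>bucket U (q k) m. node_fun k v < node_fun k u) \<longrightarrow>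
        \<not> z (with_oracle f v)))"

lemma length_rectangles: "length rectangles = length C * M"
  by (simp add: rectangles_def)

lemma node_fun_eq:
  "k < length C \<Longrightarrow>
    node_fun k x = real_node_value x (take k (node_values (real_node_value x) C)) (C ! k)"
  by (simp add: node_fun_def nth_node_values)

lemma node_ok: "k < length C \<Longrightarrow> real_node_ok n k (C ! k)"
  using circuit by (simp add: monotone_real_circuit_def)

lemma nth_with_oracle_input:
  "x \<in> U \<union> V \<Longrightarrow> i < n \<Longrightarrow> with_oracle f x ! i = x ! i"
  using cube by (auto simp: with_oracle_def cube_def nth_append)

lemma nth_with_oracle_oracle:
  "x \<in> U \<union> V \<Longrightarrow> j < length rectangles \<Longrightarrow> with_oracle f x ! (n + j) = f j x"
  using cube by (auto simp: with_oracle_def cube_def nth_append)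

text \<open>An element below some but not all of the bucket is straddled, hence rejected by the
  oracle bit; one below the whole bucket is already rejected by \<open>z\<close>.\<close>

lemma separates_bucket_conj_oracle:
  assumes z: "separates_below (j div M) (j mod M) z" and j: "j < length rectangles"
  shows "separates_bucket (j div M) (j mod M) (\<lambda>x. z x \<and> x ! (n + j))"
  unfolding separates_bucket_def
proof (intro allI impI conjI ballI)
  let ?k = "j div M" and ?m = "j mod M"
  fix f assume f: "admissible f"
  have fj: "\<And>u. u \<in> bucket U (q ?k) ?m \<Longrightarrow> f j u"
    "\<And>v. v \<in> straddled U V (node_fun ?k) (q ?k) ?m \<Longrightarrow> \<not> f j v"
    using f j unfolding admissible_def by (auto simp: rectangles_def)
  {
    fix u assume u: "u \<in> bucket U (q ?k) ?m"
    then show "z (with_oracle f u)" using z f by (simp add: separates_below_def)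
    show "with_oracle f u ! (n + j)"
      using fj(1)[OF u] u j by (simp add: nth_with_oracle_oracle bucket_def)
  next
    fix v assume v: "v \<in> V" and ex: "\<exists>u\<in>bucket U (q ?k) ?m. node_fun ?k v < node_fun ?k u"
    show "\<not> (z (with_oracle f v) \<and> with_oracle f v ! (n + j))"
    proof (cases "\<forall>u\<in>bucket U (q ?k) ?m. node_fun ?k v < node_fun ?k u")
      case True
      then show ?thesis using z f v ex unfolding separates_below_def by blast
    next
      case False
      then have "v \<in> straddled U V (node_fun ?k) (q ?k) ?m"
        using v ex by (auto simp: straddled_def not_less)
      then show ?thesis using fj(2) v j by (simp add: nth_with_oracle_oracle)
    qed
  }
qed

text \<open>The disjunction ranges over pairs of bucket indices instead of elements
  \<open>u\<close>, since the term of \<open>u\<close> depends only on its two buckets. This leaves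
  at most \<open>M * M\<close> terms, however large \<open>U\<close> is.\<close>

lemma separates_below_gate:
  assumes mono: "\<And>u v. node_fun k v < node_fun k u \<Longrightarrow> node_fun i v < node_fun i u \<or> node_fun j v < node_fun j u"
    and a: "\<And>l. l < M \<Longrightarrow> separates_bucket i l (a l)"
    and b: "\<And>l. l < M \<Longrightarrow> separates_bucket j l (b l)"
  shows "separates_below k m
    (\<lambda>x. \<exists>p\<in>(\<lambda>u. (q i u, q j u)) ` bucket U (q k) m. a (fst p) x \<and> b (snd p) x)"
  unfolding separates_below_def
proof (intro allI impI conjI ballI)
  fix f assume f: "admissible f"
  have in_bucket: "u \<in> bucket U (q l) (q l u)" if "u \<in> bucket U (q k) m" for u l
    using that by (simp add: bucket_def)
  {
    fix u assume u: "u \<in> bucket U (q k) m"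
    have "a (q i u) (with_oracle f u)" "b (q j u) (with_oracle f u)"
      using a[OF q_less] b[OF q_less] f in_bucket[OF u] unfolding separates_bucket_def by blast+
    then show "\<exists>p\<in>(\<lambda>u. (q i u, q j u)) ` bucket U (q k) m.
        a (fst p) (with_oracle f u) \<and> b (snd p) (with_oracle f u)"
      using u by auto
  next
    fix v assume v: "v \<in> V"
      "bucket U (q k) m \<noteq> {} \<and> (\<forall>u\<in>bucket U (q k) m. node_fun k v < node_fun k u)"
    have "\<not> (a (q i u) (with_oracle f v) \<and> b (q j u) (with_oracle f v))"
      if u: "u \<in> bucket U (q k) m" for u
      using mono[of v u] v u a[OF q_less] b[OF q_less] f in_bucket[OF u]
      unfolding separates_bucket_def by blast
    then show "\<not> (\<exists>p\<in>(\<lambda>u. (q i u, q j u)) ` bucket U (q k) m.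
        a (fst p) (with_oracle f v) \<and> b (snd p) (with_oracle f v))"
      by auto
  }
qed

section \<open>Building the bits of all buckets and counting nodes\<close>

lemma computable_gate:
  assumes F: "computable_within N K F"
    and mono: "\<And>u v. node_fun k v < node_fun k u \<Longrightarrow> node_fun i v < node_fun i u \<or> node_fun j v < node_fun j u"
    and i: "\<And>l. l < M \<Longrightarrow> \<exists>w\<in>F. separates_bucket i l w"
    and j: "\<And>l. l < M \<Longrightarrow> \<exists>w\<in>F. separates_bucket j l w"
  shows "\<exists>z. computable_within N (K + (2 * M\<^sup>2 + 1)) (insert z F) \<and> separates_below k m z"
proof -
  obtain a where a: "\<And>l. l < M \<Longrightarrow> a l \<in> F" "\<And>l. l < M \<Longrightarrow> separates_bucket i l (a l)"
    using i by metis
  obtain b where b: "\<And>l. l < M \<Longrightarrow> b l \<in> F" "\<And>l. l < M \<Longrightarrow> separates_bucket j l (b l)"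
    using j by metis
  define I where "I = (\<lambda>u. (q i u, q j u)) ` bucket U (q k) m"
  have I: "I \<subseteq> {..<M} \<times> {..<M}" using q_less by (auto simp: I_def)
  then have fin: "finite I" by (rule finite_subset) simp
  have "card I \<le> M\<^sup>2"
    using card_mono[OF _ I] by (simp add: power2_eq_square)
  moreover have "computable_within N (K + (2 * card I + 1)) (insert (\<lambda>x. \<exists>p\<in>I. a (fst p) x \<and> b (snd p) x) F)"
    using I a(1) b(1) by (intro computable_within_DNF fin F) auto
  ultimately have "computable_within N (K + (2 * M\<^sup>2 + 1)) (insert (\<lambda>x. \<exists>p\<in>I. a (fst p) x \<and> b (snd p) x) F)"
    by (elim computable_within_mono) auto
  moreover have "separates_below k m (\<lambda>x. \<exists>p\<in>I. a (fst p) x \<and> b (snd p) x)"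
    unfolding I_def by (intro separates_below_gate mono a(2) b(2))
  ultimately show ?thesis by blast
qed

lemma computable_below:
  assumes F: "computable_within (n + length rectangles) K F" and k: "k < length C"
    and preds: "\<And>i l. i < k \<Longrightarrow> l < M \<Longrightarrow> \<exists>w\<in>F. separates_bucket i l w"
  shows "\<exists>z. computable_within (n + length rectangles) (K + (2 * M\<^sup>2 + 1)) (insert z F) \<and>
    separates_below k m z"
proof (cases "C ! k")
  case (RInput i)
  then have i: "i < n" using node_ok[OF k] by simp
  have val: "node_fun k x = of_bool (x ! i)" for x using node_fun_eq[OF k] RInput by simp
  \<comment> \<open>Input values are 0 or 1. If some element of the bucket has value 0, no
    \<open>v\<close> lies strictly below it, so nothing must be rejected and the constant
    \<open>True\<close> suffices.\<close>
  show ?thesis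
  proof (cases "\<forall>u\<in>bucket U (q k) m. u ! i")
    case True
    have "separates_below k m (\<lambda>x. x ! i)"
      unfolding separates_below_def
      using True i by (auto simp: val nth_with_oracle_input bucket_def)
    moreover have "computable_within (n + length rectangles) (K + (2 * M\<^sup>2 + 1)) (insert (\<lambda>x. x ! i) F)"
      by (rule computable_within_mono[OF computable_within_input[OF F, of i]]) (use i in auto)
    ultimately show ?thesis by blast
  next
    case False
    then have "separates_below k m (\<lambda>x. True)"
      unfolding separates_below_def by (force simp: val)
    moreover have "computable_within (n + length rectangles) (K + (2 * M\<^sup>2 + 1)) (insert (\<lambda>x. True) F)"
      by (rule computable_within_mono[OF computable_within_const[OF F]]) auto
    ultimately show ?thesis by blast
  qed
next
  case (RConst r)
  then have "node_fun k x = r" for x using node_fun_eq[OF k] by simp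
  then have "separates_below k m (\<lambda>x. True)"
    unfolding separates_below_def by auto
  moreover have "computable_within (n + length rectangles) (K + (2 * M\<^sup>2 + 1)) (insert (\<lambda>x. True) F)"
    by (rule computable_within_mono[OF computable_within_const[OF F]]) auto
  ultimately show ?thesis by blast
next
  case (RUnary g i)
  then have g: "mono g" and i: "i < k" using node_ok[OF k] by auto
  have val: "node_fun k x = g (node_fun i x)" for x
    using node_fun_eq[OF k] RUnary i by (simp add: node_fun_def)
  \<comment> \<open>A unary gate is treated as a binary one whose two predecessors coincide.\<close>
  show ?thesis
  proof (rule computable_gate[OF F, of k i i])
    show "node_fun i v < node_fun i u \<or> node_fun i v < node_fun i u" if "node_fun k v < node_fun k u" for u v
      using that monoD[OF g, of "node_fun i u" "node_fun i v"] by (auto simp: val not_less[symmetric])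
  qed (use preds i in auto)
next
  case (RBinary g i j)
  then have g: "\<And>a a' b b'. a \<le> a' \<Longrightarrow> b \<le> b' \<Longrightarrow> g a b \<le> g a' b'" and ij: "i < k" "j < k"
    using node_ok[OF k] by auto
  have val: "node_fun k x = g (node_fun i x) (node_fun j x)" for x
    using node_fun_eq[OF k] RBinary ij by (simp add: node_fun_def)
  show ?thesis
  proof (rule computable_gate[OF F, of k i j])
    show "node_fun i v < node_fun i u \<or> node_fun j v < node_fun j u" if "node_fun k v < node_fun k u" for u v
      using that g[of "node_fun i u" "node_fun i v" "node_fun j u" "node_fun j v"]
      by (auto simp: val not_less[symmetric])
  qed (use preds ij in auto)
qed

text \<open>Each bucket costs at most \<open>2 * M\<^sup>2 + 1\<close> nodes for its disjunction,
  one for reading the oracle bit and one for the final conjunction.\<close>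

lemma computable_buckets:
  assumes "t \<le> length C * M"
  shows "\<exists>F. computable_within (n + length rectangles) (t * (2 * M\<^sup>2 + 3)) F \<and>
    (\<forall>j<t. \<exists>w\<in>F. separates_bucket (j div M) (j mod M) w)"
  using assms
proof (induction t)
  case 0
  show ?case by (rule exI[of _ "{}"]) (simp add: computable_within_empty)
next
  case (Suc t)
  then obtain F where F: "computable_within (n + length rectangles) (t * (2 * M\<^sup>2 + 3)) F"
    and sep: "\<And>j. j < t \<Longrightarrow> \<exists>w\<in>F. separates_bucket (j div M) (j mod M) w"
    by auto
  have t: "t < length rectangles" using Suc.prems by (simp add: length_rectangles)
  then have k: "t div M < length C"
    by (simp add: length_rectangles less_mult_imp_div_less)
  \<comment> \<open>In the chosen numbering every bucket of an earlier node has an index below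
    \<open>t\<close>, so its bit is already in \<open>F\<close>.\<close>
  have preds: "\<exists>w\<in>F. separates_bucket i l w" if "i < t div M" "l < M" for i l
  proof -
    have "i * M + l < (i + 1) * M" using that by simp
    also have "\<dots> \<le> t div M * M" using that by (intro mult_right_mono) auto
    also have "\<dots> \<le> t" by simp
    finally show ?thesis using sep[of "i * M + l"] that by simp
  qed
  obtain z where z: "computable_within (n + length rectangles) (t * (2 * M\<^sup>2 + 3) + (2 * M\<^sup>2 + 1)) (insert z F)"
      "separates_below (t div M) (t mod M) z"
    using computable_below[OF F k preds] by blast
  let ?w = "\<lambda>x. z x \<and> x ! (n + t)"
  have "computable_within (n + length rectangles) (t * (2 * M\<^sup>2 + 3) + (2 * M\<^sup>2 + 1) + 1)
      (insert (\<lambda>x. x ! (n + t)) (insert z F))"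
    using t by (intro computable_within_input z) auto
  then have "computable_within (n + length rectangles) (t * (2 * M\<^sup>2 + 3) + (2 * M\<^sup>2 + 1) + 1 + 1)
      (insert ?w (insert (\<lambda>x. x ! (n + t)) (insert z F)))"
    by (rule computable_within_conj) auto
  then have "computable_within (n + length rectangles) (Suc t * (2 * M\<^sup>2 + 3)) (insert ?w F)"
    by (rule computable_within_mono) auto
  then show ?case
    using sep separates_bucket_conj_oracle[OF z(2) t] 
    by (intro exI[of _ "insert ?w F"]) (auto simp: less_Suc_eq)
qed

text \<open>At the output node every \<open>v\<close> has value 0 and every \<open>u\<close> value
  1, so each non-empty bucket's bit rejects all of \<open>V\<close>. The disjunction of these bits
  therefore separates \<open>U\<close> from \<open>V\<close>.\<close>

lemma exists_CLO:
  assumes sep: "real_circuit_separates C U V"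
  obtains D where "monotone_CLO n U V D rectangles"
    and "length D \<le> length C * M * (2 * M\<^sup>2 + 3) + 2 * M + 2"
proof -
  define k where "k = length C - 1"
  have C: "C \<noteq> []" using circuit by (simp add: monotone_real_circuit_def)
  have out: "real_eval C x = node_fun k x" for x
    using C by (simp add: real_eval_def output_value_eq_nth node_fun_def k_def)
  have vals: "\<And>u. u \<in> U \<Longrightarrow> node_fun k u = 1" "\<And>v. v \<in> V \<Longrightarrow> node_fun k v = 0"
    using sep by (auto simp: real_circuit_separates_def out)
  obtain F where F: "computable_within (n + length rectangles) (length C * M * (2 * M\<^sup>2 + 3)) F"
    and Fsep: "\<And>j. j < length C * M \<Longrightarrow> \<exists>w\<in>F. separates_bucket (j div M) (j mod M) w"
    using computable_buckets[of "length C * M"] by auto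
  have bits: "\<exists>w\<in>F. separates_bucket k m w" if "m < M" for m
  proof -
    have "k * M + m < (k + 1) * M" using that by simp
    also have "k + 1 = length C" using C by (simp add: k_def)
    finally show ?thesis using Fsep[of "k * M + m"] that by simp
  qed
  obtain w where w: "\<And>m. m < M \<Longrightarrow> w m \<in> F" "\<And>m. m < M \<Longrightarrow> separates_bucket k m (w m)"
    using bits by metis
  define I where "I = q k ` U"
  have I: "I \<subseteq> {..<M}" using q_less by (auto simp: I_def)
  then have finI: "finite I" by (rule finite_subset) simp
  have cardI: "card I \<le> M" using card_mono[OF _ I] by simp
  \<comment> \<open>Each bit is conjoined with itself only to fit the form of
    \<open>computable_within_DNF\<close>.\<close>
  let ?out = "\<lambda>x. \<exists>m\<in>I. w m x \<and> w m x"
  have "computable_within (n + length rectangles)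
      (length C * M * (2 * M\<^sup>2 + 3) + (2 * card I + 1)) (insert ?out F)"
    using I w(1) by (intro computable_within_DNF finI F) auto
  then obtain D where D: "monotone_bool_circuit (n + length rectangles) D"
      "length D \<le> length C * M * (2 * M\<^sup>2 + 3) + (2 * card I + 1) + 1" "\<And>x. bool_eval D x = ?out x"
    by (rule computable_within_circuit[OF _ insertI1]) (rule that)
  have "monotone_CLO n U V D rectangles"
    unfolding monotone_CLO_def
  proof (intro conjI allI impI)
    show "\<forall>(A, B)\<in>set rectangles. A \<subseteq> U \<and> B \<subseteq> V"
      by (auto simp: rectangles_def bucket_def straddled_def)
  next
    fix f :: "nat \<Rightarrow> bool list \<Rightarrow> bool"
    assume "\<forall>j<length rectangles. monotone_on (cube n) (\<preceq>) (\<le>) (f j) \<and>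
      (\<forall>u\<in>fst (rectangles ! j). f j u) \<and> (\<forall>v\<in>snd (rectangles ! j). \<not> f j v)"
    then have f: "admissible f" by (simp add: admissible_def)
    have in_bucket: "u \<in> bucket U (q k) (q k u)" if "u \<in> U" for u
      using that by (simp add: bucket_def)
    have "bool_eval D (with_oracle f u)" if "u \<in> U" for u
    proof -
      have "w (q k u) (with_oracle f u)"
        using w(2)[OF q_less] f in_bucket[OF that] unfolding separates_bucket_def by blast
      then show ?thesis using that by (auto simp: D(3) I_def)
    qed
    then show "\<forall>u\<in>U. bool_eval D (u @ map (\<lambda>j. f j u) [0..<length rectangles])"
      by (simp add: with_oracle_def)
    have "\<not> bool_eval D (with_oracle f v)" if "v \<in> V" for v
    proof -
      have "\<not> w (q k u) (with_oracle f v)" if "u \<in> U" for u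
      proof -
        have "node_fun k v < node_fun k u" using vals \<open>v \<in> V\<close> that by simp
        then show ?thesis
          using w(2)[OF q_less] f in_bucket[OF that] \<open>v \<in> V\<close> unfolding separates_bucket_def by blast
      qed
      then show ?thesis by (auto simp: D(3) I_def)
    qed
    then show "\<forall>v\<in>V. \<not> bool_eval D (v @ map (\<lambda>j. f j v) [0..<length rectangles])"
      by (simp add: with_oracle_def)
  qed (rule D(1))
  then show ?thesis using that D(2) cardI by fastforce
qed

lemma locality_rectangles:
  assumes fin: "finite U" "finite V"
    and small: "\<And>k. real (card (\<Union>m. bucket U (q k) m \<times> straddled U V (node_fun k) (q k) m))
      \<le> \<epsilon> * real (card (U \<times> V))"
    and \<epsilon>: "\<epsilon> \<ge> 0"
  shows "locality U V rectangles \<le> real (length C) * \<epsilon>"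
proof -
  let ?B = "\<lambda>k. \<Union>m. bucket U (q k) m \<times> straddled U V (node_fun k) (q k) m"
  have finB: "finite (\<Union>k<length C. ?B k)"
    by (rule finite_subset[of _ "U \<times> V"]) (use fin in \<open>auto simp: bucket_def straddled_def\<close>)
  have "(\<Union>(A, B)\<in>set rectangles. A \<times> B) \<subseteq> (\<Union>k<length C. ?B k)"
    by (fastforce simp: rectangles_def less_mult_imp_div_less)
  then have "card (\<Union>(A, B)\<in>set rectangles. A \<times> B) \<le> card (\<Union>k<length C. ?B k)"
    by (rule card_mono[OF finB])
  also have "\<dots> \<le> (\<Sum>k<length C. card (?B k))"
    by (rule card_UN_le) simp
  finally have "real (card (\<Union>(A, B)\<in>set rectangles. A \<times> B)) \<le> (\<Sum>k<length C. real (card (?B k)))"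
    by (simp flip: of_nat_sum)
  also have "\<dots> \<le> (\<Sum>k<length C. \<epsilon> * real (card (U \<times> V)))"
    by (intro sum_mono small)
  finally have "real (card (\<Union>(A, B)\<in>set rectangles. A \<times> B)) \<le> real (length C) * \<epsilon> * real (card (U \<times> V))"
    by simp
  \<comment> \<open>If the product is empty, the locality is a division by zero, hence 0, and the
    bound follows from \<epsilon> being non-negative.\<close>
  then show ?thesis
    unfolding locality_def using \<epsilon>
    by (cases "card (U \<times> V) = 0") (simp_all add: pos_divide_le_eq del: card_cartesian_product)
qed

end

section \<open>The size bounds\<close>

lemma finite_cube: "finite (cube n)"
  using finite_lists_length_eq[of "UNIV :: bool set" n] by (simp add: cube_def)

text \<open>A cube of dimension 0 has a single point. The bound on \<open>n\<close> later allows
  \<open>1 / \<epsilon>\<close> to be replaced by \<open>n / \<epsilon>\<close>.\<close>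

lemma separated_imp_pos_dim:
  assumes "U \<subseteq> cube n" "V \<subseteq> cube n" "U \<inter> V = {}" "U \<noteq> {}" "V \<noteq> {}"
  shows "n \<ge> 1"
proof (rule ccontr)
  assume "\<not> n \<ge> 1"
  then have "cube n = {[]}" by (cases n) (auto simp: cube_def)
  then show False using assms by (metis Int_absorb subset_singletonD)
qed

lemma exists_CLO_locality_epsilon:
  assumes UV: "U \<subseteq> cube n" "V \<subseteq> cube n" "U \<noteq> {}" "V \<noteq> {}" and n: "n \<ge> 1"
    and C: "monotone_real_circuit n C" "real_circuit_separates C U V"
    and \<epsilon>: "0 < \<epsilon>" "\<epsilon> < 1 / 2"
  shows "\<exists>D R. monotone_CLO n U V D R \<and>
    real (length D) \<le> real (length C) * (real n / \<epsilon>) ^ 8 \<and> locality U V R \<le> real (length C) * \<epsilon>"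
proof -
  define M where "M = nat \<lfloor>1 / \<epsilon>\<rfloor> + 1"
  have fin: "finite U" "finite V" using UV finite_cube finite_subset by metis+
  \<comment> \<open>Buckets are chosen for every natural number \<open>k\<close>, also beyond the
    circuit, where the list entry is unspecified: any real function admits a bucketing.\<close>
  define good where "good k q \<longleftrightarrow> (\<forall>u. q u < M) \<and> real (card (\<Union>m. bucket U q m \<times>
      straddled U V (\<lambda>x. node_values (real_node_value x) C ! k) q m)) \<le> \<epsilon> * real (card (U \<times> V))" for k q
  have "\<exists>q. good k q" for k
    unfolding good_def M_def by (rule exists_bucketing[OF fin UV(4) \<epsilon>(1)]) blast
  then obtain q where "\<And>k. good k (q k)"
    by metis
  then have q: "\<And>k u. q k u < M" "\<And>k. real (card (\<Union>m. bucket U (q k) m \<times>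
      straddled U V (\<lambda>x. node_values (real_node_value x) C ! k) (q k) m)) \<le> \<epsilon> * real (card (U \<times> V))"
    unfolding good_def by blast+
  interpret bucketed_real_circuit n U V C q M
    using UV C q(1) by unfold_locales auto
  have nf: "node_fun k = (\<lambda>x. node_values (real_node_value x) C ! k)" for k
    by (simp add: node_fun_def fun_eq_iff)
  have loc: "locality U V rectangles \<le> real (length C) * \<epsilon>"
    by (intro locality_rectangles fin) (use q(2) \<epsilon> in \<open>simp_all add: nf\<close>)
  obtain D where D: "monotone_CLO n U V D rectangles"
    "length D \<le> length C * M * (2 * M\<^sup>2 + 3) + 2 * M + 2"
    using exists_CLO[OF C(2)] by metis
  define s where "s = real (length C)"
  define y where "y = 1 / \<epsilon>"
  have s: "s \<ge> 1" using C(1) by (cases C) (auto simp: s_def monotone_real_circuit_def)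
  have y: "y > 2" using \<epsilon> by (simp add: y_def field_simps)
  have M: "real M \<le> 2 * y" using y unfolding M_def y_def by linarith
  have "real (length D) \<le> s * (real M * (2 * (real M)\<^sup>2 + 3)) + (2 * real M + 2)"
    using D(2) unfolding s_def by (simp flip: of_nat_le_iff[where 'a=real] add: algebra_simps)
  also have "\<dots> \<le> s * (real M * (2 * (real M)\<^sup>2 + 3)) + s * (2 * real M + 2)"
    using mult_right_mono[OF s, of "2 * real M + 2"] by simp
  also have "\<dots> = s * (real M * (2 * (real M)\<^sup>2 + 3) + (2 * real M + 2))"
    by (simp add: algebra_simps)
  also have "\<dots> \<le> s * ((2 * y) * (2 * (2 * y)\<^sup>2 + 3) + (2 * (2 * y) + 2))"
    using s M by (intro mult_left_mono add_mono mult_mono power_mono) auto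
  \<comment> \<open>The polynomial is cubic in \<open>y\<close> with total weight at most 32, and
    the factor 32 is absorbed by \<open>y ^ 5\<close> because \<open>y > 2\<close>. This yields the
    exponent 8.\<close>
  also have "\<dots> \<le> s * y ^ 8"
  proof (intro mult_left_mono)
    have y2: "y\<^sup>2 \<ge> 2\<^sup>2" and y5: "y ^ 5 \<ge> 2 ^ 5" using y by (intro power_mono; simp)+
    have "y ^ 3 = y * y\<^sup>2" by (simp add: power3_eq_cube power2_eq_square)
    also have "\<dots> \<ge> y * 4" using y2 y by (intro mult_left_mono) auto
    finally have y3: "y ^ 3 \<ge> 4 * y" by simp
    have "(2 * y) * (2 * (2 * y)\<^sup>2 + 3) + (2 * (2 * y) + 2) = 16 * y ^ 3 + 10 * y + 2"
      by (simp add: power3_eq_cube power2_eq_square algebra_simps)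
    also have "\<dots> \<le> 32 * y ^ 3" using y3 y by linarith
    also have "\<dots> \<le> y ^ 5 * y ^ 3" using y5 y by (intro mult_right_mono) auto
    also have "\<dots> = y ^ 8" by (simp flip: power_add)
    finally show "(2 * y) * (2 * (2 * y)\<^sup>2 + 3) + (2 * (2 * y) + 2) \<le> y ^ 8" .
  qed (use s in simp)
  also have "\<dots> \<le> s * (real n / \<epsilon>) ^ 8"
    using s n \<epsilon> unfolding y_def by (intro mult_left_mono power_mono divide_right_mono) auto
  finally show ?thesis using D(1) loc unfolding s_def by blast
qed

section \<open>Circuits of prescribed locality\<close>

lemma whole_rectangle_CLO:
  assumes "U \<subseteq> cube n" "V \<subseteq> cube n"
  shows "monotone_CLO n U V [BInput n] [(U, V)]"
  using assms by (auto simp: monotone_CLO_def monotone_bool_circuit_def bool_eval_def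
    output_value_def node_values_def cube_def nth_append)

text \<open>A lone node has no predecessors and cannot be constant, as it takes both values 0 and 1.
  It is therefore an input, which also serves as a Boolean circuit without oracle.\<close>

lemma exists_CLO_single_node:
  assumes UV: "U \<subseteq> cube n" "V \<subseteq> cube n" "U \<noteq> {}" "V \<noteq> {}"
    and C: "monotone_real_circuit n C" "real_circuit_separates C U V" "length C = 1"
  obtains i where "monotone_CLO n U V [BInput i] []"
proof -
  obtain g where g: "C = [g]" using C(3) by (auto simp: length_Suc_conv)
  have val: "real_eval C x = real_node_value x [] g" for x
    by (simp add: g real_eval_def output_value_def node_values_def)
  have ok: "real_node_ok n 0 g" using C(1) by (simp add: g monotone_real_circuit_def)
  have one: "\<forall>u\<in>U. real_node_value u [] g = 1" and zero: "\<forall>v\<in>V. real_node_value v [] g = 0"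
    using C(2) by (auto simp: real_circuit_separates_def val)
  obtain i where i: "g = RInput i" using ok one zero UV by (cases g) auto
  have "monotone_CLO n U V [BInput i] []"
    using ok one zero by (auto simp: i monotone_CLO_def monotone_bool_circuit_def bool_eval_def
      output_value_def node_values_def)
  then show ?thesis by (rule that)
qed

text \<open>The choice \<epsilon> = \<mu> / s is below 1/2 when \<mu> < 1 and the circuit has at
  least two nodes; the other cases have one-node solutions. For large \<mu> the product can drop
  below 1 while a circuit still has a node, whence the \<open>max 1\<close>.\<close>

lemma exists_CLO_locality_mu:
  assumes UV: "U \<subseteq> cube n" "V \<subseteq> cube n" "U \<noteq> {}" "V \<noteq> {}" and n: "n \<ge> 1"
    and C: "monotone_real_circuit n C" "real_circuit_separates C U V" and \<mu>: "0 < \<mu>"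
  shows "\<exists>D R. monotone_CLO n U V D R \<and> locality U V R \<le> \<mu> \<and>
    real (length D) \<le> max 1 (real n * real (length C) * inverse \<mu>) ^ 9"
proof -
  let ?N = "real n * real (length C) * inverse \<mu>"
  have "length C \<ge> 1" using C(1) by (simp add: monotone_real_circuit_def Suc_le_eq)
  then consider "\<mu> \<ge> 1" | "length C = 1" | "\<mu> < 1" "length C \<ge> 2"
    by linarith
  then show ?thesis
  proof cases
    case 1
    \<comment> \<open>The whole product as a single rectangle has locality 1, and the circuit just
      outputs its oracle bit, which is input number \<open>n\<close>.\<close>
    have "locality U V [(U, V)] \<le> \<mu>"
      using 1 by (simp add: locality_def divide_self_if)
    then show ?thesis
      using whole_rectangle_CLO[OF UV(1,2)] by (intro exI[of _ "[BInput n]"] exI[of _ "[(U, V)]"]) simp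
  next
    case 2
    obtain i where "monotone_CLO n U V [BInput i] []"
      using exists_CLO_single_node[OF UV C 2] .
    then show ?thesis
      using \<mu> by (intro exI[of _ "[BInput i]"] exI[of _ "[]"]) (simp add: locality_def)
  next
    case 3
    let ?s = "real (length C)"
    have s: "?s \<ge> 2" using 3 by simp
    have \<epsilon>: "0 < \<mu> / ?s" "\<mu> / ?s < 1 / 2" using 3 \<mu> s by (auto simp: divide_less_eq zero_less_divide_iff)
    obtain D R where D: "monotone_CLO n U V D R"
      "real (length D) \<le> ?s * (real n / (\<mu> / ?s)) ^ 8" "locality U V R \<le> ?s * (\<mu> / ?s)"
      using exists_CLO_locality_epsilon[OF UV n C \<epsilon>] by blast
    have N: "real n / (\<mu> / ?s) = ?N" by (simp add: field_simps)
    \<comment> \<open>The remaining factor \<open>?s\<close> is at most \<open>?N\<close>, which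
      raises the exponent from 8 to 9.\<close>
    have "1 * ?s * 1 \<le> ?N"
      using n 3 \<mu> by (intro mult_mono) (auto simp: one_le_inverse_iff)
    then have sN: "?s \<le> ?N" by simp
    have "real (length D) \<le> ?s * ?N ^ 8" using D(2) unfolding N .
    also have "\<dots> \<le> ?N * ?N ^ 8" using sN s by (intro mult_right_mono) auto
    also have "\<dots> = ?N ^ 9" by (simp flip: power_Suc)
    also have "\<dots> \<le> max 1 ?N ^ 9" using sN s by (intro power_mono) auto
    finally show ?thesis using D(1,3) s by (intro exI[of _ D] exI[of _ R]) (auto split: if_splits)
  qed
qed

theorem lemma6p2:
  "\<exists>c\<^sub>1 c\<^sub>2 :: nat. \<forall>(n :: nat) (U :: bool list set) (V :: bool list set) (C :: real_node list) (s :: nat).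
     U \<subseteq> cube n \<and> V \<subseteq> cube n \<and> U \<inter> V = {} \<and> U \<noteq> {} \<and> V \<noteq> {} \<and>
     (upward_closed n U \<or> downward_closed n V) \<and>
     monotone_real_circuit n C \<and> length C = s \<and> real_circuit_separates C U V \<longrightarrow>
     (\<forall>\<epsilon>::real. 0 < \<epsilon> \<and> \<epsilon> < 1 / 2 \<longrightarrow>
        (\<exists>D R. monotone_CLO n U V D R \<and>
           real (length D) \<le> real s * (real n / \<epsilon>) ^ c\<^sub>1 \<and>
           locality U V R \<le> real s * \<epsilon>)) \<and>
     (\<forall>\<mu>::real. 0 < \<mu> \<longrightarrow>
        (\<exists>D R. monotone_CLO n U V D R \<and>
           locality U V R \<le> \<mu> \<and>
           real (length D) \<le> max 1 (real n * real s * inverse \<mu>) ^ c\<^sub>2))"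
proof (rule exI[of _ 8], rule exI[of _ 9], intro allI impI)
  fix n U V C s
  assume "U \<subseteq> cube n \<and> V \<subseteq> cube n \<and> U \<inter> V = {} \<and> U \<noteq> {} \<and> V \<noteq> {} \<and>
    (upward_closed n U \<or> downward_closed n V) \<and>
    monotone_real_circuit n C \<and> length C = s \<and> real_circuit_separates C U V"
  then have UV: "U \<subseteq> cube n" "V \<subseteq> cube n" "U \<noteq> {}" "V \<noteq> {}" and "U \<inter> V = {}"
    and C: "monotone_real_circuit n C" "real_circuit_separates C U V" and s: "s = length C"
    by auto
  then have n: "n \<ge> 1" by (intro separated_imp_pos_dim[of U n V])
  show "(\<forall>\<epsilon>::real. 0 < \<epsilon> \<and> \<epsilon> < 1 / 2 \<longrightarrow>
        (\<exists>D R. monotone_CLO n U V D R \<and>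
           real (length D) \<le> real s * (real n / \<epsilon>) ^ 8 \<and>
           locality U V R \<le> real s * \<epsilon>)) \<and>
     (\<forall>\<mu>::real. 0 < \<mu> \<longrightarrow>
        (\<exists>D R. monotone_CLO n U V D R \<and>
           locality U V R \<le> \<mu> \<and>
           real (length D) \<le> max 1 (real n * real s * inverse \<mu>) ^ 9))"
    unfolding s
    by (intro conjI allI impI exists_CLO_locality_epsilon[OF UV n C] exists_CLO_locality_mu[OF UV n C])
      simp_all
qed

end
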